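(* Let $\Delta y=\Delta x>0$. The multi-dimensional extension of the Yee scheme for the two-dimensional Maxwell equations, in both its collocated form and its staggered form given in the context, is stable (in the von Neumann sense given in the context) for $\mathrm{CFL}:=\frac{\Delta t}{\Delta x}<1$.
   Context: The system is $\partial_tB^z=-(\partial_xE^y-\partial_yE^x)$, $\partial_tE^x=\partial_yB^z$, $\partial_tE^y=-\partial_xB^z$ on a Cartesian grid with spacings $\Delta x,\Delta y$ and time step $\Delta t>0$. *Collocated form* (all variables indexed by $(i,j)\in\mathbb Z^2$): $$\frac{(B^z)^{n+1}_{ij}-(B^z)^n_{ij}}{\Delta t}=-\left(\frac{(E^y)^n_{i+1,j+1}-(E^y)^n_{i,j+1}+(E^y)^n_{i+1,j}-(E^y)^n_{ij}}{2\Delta x}-\frac{(E^x)^n_{i+1,j+1}-(E^x)^n_{i+1,j}+(E^x)^n_{i,j+1}-(E^x)^n_{ij}}{2\Delta y}\right),$$ $$\frac{(E^x)^{n+1}_{ij}-(E^x)^n_{ij}}{\Delta t}=\frac{(B^z)^{n+1}_{ij}-(B^z)^{n+1}_{i,j-1}+(B^z)^{n+1}_{i-1,j}-(B^z)^{n+1}_{i-1,j-1}}{2\Delta y},$$ $$\frac{(E^y)^{n+1}_{ij}-(E^y)^n_{ij}}{\Delta t}=-\frac{(B^z)^{n+1}_{ij}-(B^z)^{n+1}_{i-1,j}+(B^z)^{n+1}_{i,j-1}-(B^z)^{n+1}_{i-1,j-1}}{2\Delta x}.$$ *Staggered form*: the same equations in which $B^z_{ij}$ is everywhere renamed $B^z_{i+\frac12,j+\frac12}$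 (stored at vertices), so that $B^z_{i,j-1}$, $B^z_{i-1,j}$, $B^z_{i-1,j-1}$ become $B^z_{i+\frac12,j-\frac12}$, $B^z_{i-\frac12,j+\frac12}$, $B^z_{i-\frac12,j-\frac12}$, while $E^x_{ij},E^y_{ij}$ stay at cell centers. *Stability*: inserting $q^n_{ij}=\hat q^n\exp(\mathrm i\beta_xi+\mathrm i\beta_yj)$ for $q=(B^z,E^x,E^y)$ (with $B^z_{i+\frac12,j+\frac12}$ in the role of $B^z_{ij}$ in the staggered form) and eliminating $(B^z)^{n+1}$ from the right-hand sides gives $\hat q^{n+1}=\mathcal A(\beta_x,\beta_y)\hat q^n$ with a $3\times3$ matrix $\mathcal A$. The scheme is stable if for all $\beta_x,\beta_y\in\mathbb R$ all eigenvalues of $\mathcal A(\beta_x,\beta_y)$ lie in the closed unit disc. *)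

theory Defs
  imports Complex_Main "Jordan_Normal_Form.Char_Poly"
begin

text \<open>Grid functions are complex valued so that Fourier modes can be inserted; the coefficients
  of the schemes are real.  The first argument of a field is the time level.\<close>

definition collocated_scheme ::
  "real \<Rightarrow> real \<Rightarrow> real \<Rightarrow> (nat \<Rightarrow> int \<Rightarrow> int \<Rightarrow> complex) \<Rightarrow> (nat \<Rightarrow> int \<Rightarrow> int \<Rightarrow> complex) \<Rightarrow>
    (nat \<Rightarrow> int \<Rightarrow> int \<Rightarrow> complex) \<Rightarrow> bool"
where
  "collocated_scheme \<Delta>t \<Delta>x \<Delta>y B E\<^sub>x E\<^sub>y \<longleftrightarrow> (\<forall>n i j.
     (B (n+1) i j - B n i j) / of_real \<Delta>t =
       - ((E\<^sub>y n (i+1) (j+1) - E\<^sub>y n i (j+1) + E\<^sub>y n (i+1) j - E\<^sub>y n i j) / of_real (2 * \<Delta>x)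
        - (E\<^sub>x n (i+1) (j+1) - E\<^sub>x n (i+1) j + E\<^sub>x n i (j+1) - E\<^sub>x n i j) / of_real (2 * \<Delta>y)) \<and>
     (E\<^sub>x (n+1) i j - E\<^sub>x n i j) / of_real \<Delta>t =
       (B (n+1) i j - B (n+1) i (j-1) + B (n+1) (i-1) j - B (n+1) (i-1) (j-1))
         / of_real (2 * \<Delta>y) \<and>
     (E\<^sub>y (n+1) i j - E\<^sub>y n i j) / of_real \<Delta>t =
       - ((B (n+1) i j - B (n+1) (i-1) j + B (n+1) i (j-1) - B (n+1) (i-1) (j-1))
         / of_real (2 * \<Delta>x)))"

text \<open>In the staggered form the magnetic field carries the half-integer vertex indices
  \<open>(i + 1/2, j + 1/2)\<close>.  It is represented by a function of two real indices, whose values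
  off the vertices never enter.\<close>

definition staggered_scheme ::
  "real \<Rightarrow> real \<Rightarrow> real \<Rightarrow> (nat \<Rightarrow> real \<Rightarrow> real \<Rightarrow> complex) \<Rightarrow> (nat \<Rightarrow> int \<Rightarrow> int \<Rightarrow> complex) \<Rightarrow>
    (nat \<Rightarrow> int \<Rightarrow> int \<Rightarrow> complex) \<Rightarrow> bool"
where
  "staggered_scheme \<Delta>t \<Delta>x \<Delta>y B E\<^sub>x E\<^sub>y \<longleftrightarrow> (\<forall>n (i::int) (j::int).
     (B (n+1) (of_int i + 1/2) (of_int j + 1/2) - B n (of_int i + 1/2) (of_int j + 1/2))
         / of_real \<Delta>t =
       - ((E\<^sub>y n (i+1) (j+1) - E\<^sub>y n i (j+1) + E\<^sub>y n (i+1) j - E\<^sub>y n i j) / of_real (2 * \<Delta>x)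
        - (E\<^sub>x n (i+1) (j+1) - E\<^sub>x n (i+1) j + E\<^sub>x n i (j+1) - E\<^sub>x n i j) / of_real (2 * \<Delta>y)) \<and>
     (E\<^sub>x (n+1) i j - E\<^sub>x n i j) / of_real \<Delta>t =
       (B (n+1) (of_int i + 1/2) (of_int j + 1/2) - B (n+1) (of_int i + 1/2) (of_int j - 1/2)
        + B (n+1) (of_int i - 1/2) (of_int j + 1/2) - B (n+1) (of_int i - 1/2) (of_int j - 1/2))
         / of_real (2 * \<Delta>y) \<and>
     (E\<^sub>y (n+1) i j - E\<^sub>y n i j) / of_real \<Delta>t =
       - ((B (n+1) (of_int i + 1/2) (of_int j + 1/2) - B (n+1) (of_int i - 1/2) (of_int j + 1/2)
        + B (n+1) (of_int i + 1/2) (of_int j - 1/2) - B (n+1) (of_int i - 1/2) (of_int j - 1/2))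
         / of_real (2 * \<Delta>x)))"

definition fourier_mode :: "real \<Rightarrow> real \<Rightarrow> complex \<Rightarrow> real \<Rightarrow> real \<Rightarrow> complex" where
  "fourier_mode \<beta>x \<beta>y a x y = a * exp (\<i> * of_real (\<beta>x * x) + \<i> * of_real (\<beta>y * y))"

text \<open>Vectors of amplitudes are ordered as \<open>(B, E\<^sub>x, E\<^sub>y)\<close>.\<close>

definition collocated_on_modes ::
  "real \<Rightarrow> real \<Rightarrow> real \<Rightarrow> real \<Rightarrow> real \<Rightarrow> (nat \<Rightarrow> complex vec) \<Rightarrow> bool" where
  "collocated_on_modes \<Delta>t \<Delta>x \<Delta>y \<beta>x \<beta>y q \<longleftrightarrow> collocated_scheme \<Delta>t \<Delta>x \<Delta>y
     (\<lambda>n i j. fourier_mode \<beta>x \<beta>y (q n $ 0) (of_int i) (of_int j))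
     (\<lambda>n i j. fourier_mode \<beta>x \<beta>y (q n $ 1) (of_int i) (of_int j))
     (\<lambda>n i j. fourier_mode \<beta>x \<beta>y (q n $ 2) (of_int i) (of_int j))"

text \<open>The vertex \<open>(i + 1/2, j + 1/2)\<close> takes the role of the cell \<open>(i, j)\<close>, so the phase of the
  magnetic mode is shifted by half a cell in each direction.\<close>

definition staggered_on_modes ::
  "real \<Rightarrow> real \<Rightarrow> real \<Rightarrow> real \<Rightarrow> real \<Rightarrow> (nat \<Rightarrow> complex vec) \<Rightarrow> bool" where
  "staggered_on_modes \<Delta>t \<Delta>x \<Delta>y \<beta>x \<beta>y q \<longleftrightarrow> staggered_scheme \<Delta>t \<Delta>x \<Delta>y
     (\<lambda>n x y. fourier_mode \<beta>x \<beta>y (q n $ 0) (x - 1/2) (y - 1/2))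
     (\<lambda>n i j. fourier_mode \<beta>x \<beta>y (q n $ 1) (of_int i) (of_int j))
     (\<lambda>n i j. fourier_mode \<beta>x \<beta>y (q n $ 2) (of_int i) (of_int j))"

text \<open>The predicate \<open>S\<close> tells which sequences of amplitudes solve the scheme.  The equivalence
  determines \<open>A\<close> uniquely, since every initial amplitude starts some sequence satisfying its
  right-hand side.\<close>

definition amplification_matrix :: "((nat \<Rightarrow> complex vec) \<Rightarrow> bool) \<Rightarrow> complex mat \<Rightarrow> bool" where
  "amplification_matrix S A \<longleftrightarrow> A \<in> carrier_mat 3 3 \<and>
     (\<forall>q. (\<forall>n. q n \<in> carrier_vec 3) \<longrightarrow> (S q \<longleftrightarrow> (\<forall>n. q (n+1) = A *\<^sub>v q n)))"

definition von_neumann_stable :: "(real \<Rightarrow> real \<Rightarrow> (nat \<Rightarrow> complex vec) \<Rightarrow> bool) \<Rightarrow> bool" where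
  "von_neumann_stable S \<longleftrightarrow> (\<forall>\<beta>x \<beta>y. \<exists>A. amplification_matrix (S \<beta>x \<beta>y) A \<and>
     (\<forall>\<mu>. eigenvalue A \<mu> \<longrightarrow> cmod \<mu> \<le> 1))"

end

theory Submission
  imports Defs
begin

text \<open>On each Fourier mode the scheme is a leap-frog recursion.  With \<open>p\<close> and \<open>q\<close> the
  Fourier symbols of the differences of \<open>E\<^sub>y\<close> and \<open>E\<^sub>x\<close>, scaled by the time step, one step reads \<open>B' = B + q E\<^sub>x - p E\<^sub>y\<close>, \<open>E\<^sub>x' = E\<^sub>x - cnj q B'\<close>, \<open>E\<^sub>y' = E\<^sub>y + cnj p B'\<close>.  The
  conjugates appear because the differences of \<open>B\<close> are, up to sign, the adjoints of those of the
  electric field: this is what makes the scheme non-dissipative.  For an eigenvector to the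
  eigenvalue \<open>\<mu>\<close> primed quantities are \<open>\<mu>\<close> times the others; multiplying the first equation by \<open>\<mu> - 1\<close>
  and eliminating the electric field by the other two gives
  \<open>(\<mu> - 1)\<^sup>2 B = - s \<mu> B\<close> with the real number \<open>s = \<bar>p\<bar>\<^sup>2 + \<bar>q\<bar>\<^sup>2\<close>, so either \<open>\<mu> = 1\<close> (stationary electric
  fields with \<open>B = 0\<close>) or \<open>\<mu>\<close> is a root of the real reciprocal quadratic
  \<open>\<mu>\<^sup>2 - (2 - s) \<mu> + 1\<close>, and such a root lies on the unit circle as long as \<open>0 \<le> s \<le> 4\<close>.

  For \<open>\<Delta>y = \<Delta>x\<close> one computes \<open>s = 2 CFL\<^sup>2 (1 - cos \<beta>x cos \<beta>y) \<le> 4 CFL\<^sup>2\<close>.  Averaging each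
  difference over the transverse direction is what keeps the two contributions from being
  extremal for the same wave vector, so that the one-dimensional bound \<open>CFL < 1\<close> survives.

  In the staggered form \<open>B\<close> sits half a cell away from the electric field.  Its modes carry the
  same half-cell shift in their phase, so the equations for the amplitudes are literally those
  of the collocated form and both forms have the same amplification matrix.\<close>

section \<open>The spectrum of a leap-frog step\<close>

text \<open>The product of the two roots is \<open>1\<close>.  If they are not real, they are conjugate and hence of
  modulus one; the discriminant \<open>t\<^sup>2 - 4\<close> is not positive, which leaves only \<open>\<plusminus>1\<close> as real roots.\<close>

lemma reciprocal_quadratic_root_on_unit_circle:
  fixes \<mu> :: complex and t :: real
  assumes root: "\<mu>\<^sup>2 - of_real t * \<mu> + 1 = 0" and t: "\<bar>t\<bar> \<le> 2"
  shows "cmod \<mu> = 1"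
proof -
  have re: "(Re \<mu>)\<^sup>2 - (Im \<mu>)\<^sup>2 - t * Re \<mu> + 1 = 0"
    using arg_cong[OF root, of Re] by (simp add: power2_eq_square)
  have im: "Im \<mu> * (2 * Re \<mu> - t) = 0"
    using arg_cong[OF root, of Im] by (simp add: power2_eq_square algebra_simps)
  have "(Re \<mu>)\<^sup>2 + (Im \<mu>)\<^sup>2 = 1"
  proof (cases "Im \<mu> = 0")
    case True
    have "t * Re \<mu> \<le> \<bar>t\<bar> * \<bar>Re \<mu>\<bar>"
      by (metis abs_ge_self abs_mult)
    also have "\<dots> \<le> 2 * \<bar>Re \<mu>\<bar>"
      using t by (intro mult_right_mono) auto
    finally have "(\<bar>Re \<mu>\<bar> - 1)\<^sup>2 \<le> 0"
      using re True by (simp add: power2_eq_square algebra_simps)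
    hence "\<bar>Re \<mu>\<bar> = 1"
      by simp
    hence "(Re \<mu>)\<^sup>2 = 1"
      by (metis power2_abs one_power2)
    with True show ?thesis by simp
  next
    case False
    with im have "t = 2 * Re \<mu>" by simp
    with re show ?thesis by (simp add: power2_eq_square algebra_simps)
  qed
  thus ?thesis by (simp add: cmod_def)
qed

text \<open>The rows follow the order \<open>(B, E\<^sub>x, E\<^sub>y)\<close>; the last two arise by inserting the new \<open>B\<close> of
  the first row into \<open>E\<^sub>x' = E\<^sub>x - cnj q B'\<close> and \<open>E\<^sub>y' = E\<^sub>y + cnj p B'\<close>.\<close>

definition leapfrog_matrix :: "complex \<Rightarrow> complex \<Rightarrow> complex mat" where
  "leapfrog_matrix p q = mat_of_rows_list 3
     [[1, q, - p],
      [- cnj q, 1 - cnj q * q, cnj q * p],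
      [cnj p, cnj p * q, 1 - cnj p * p]]"

lemma leapfrog_matrix_carrier: "leapfrog_matrix p q \<in> carrier_mat 3 3"
  by (auto simp: leapfrog_matrix_def mat_of_rows_list_def intro!: carrier_matI)

lemma sum_upto_3: "(\<Sum>i = 0..<3. f i) = f 0 + f 1 + f (2::nat)"
  for f :: "nat \<Rightarrow> complex"
  by (simp add: numeral_3_eq_3 numeral_2_eq_2)

lemma eq_vec_3:
  assumes "v \<in> carrier_vec 3" "w \<in> carrier_vec 3"
  shows "v = w \<longleftrightarrow> v $ 0 = w $ 0 \<and> v $ 1 = w $ 1 \<and> v $ 2 = w $ 2"
proof
  assume eq: "v $ 0 = w $ 0 \<and> v $ 1 = w $ 1 \<and> v $ 2 = w $ 2"
  show "v = w"
  proof (rule eq_vecI)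
    fix i assume "i < dim_vec w"
    hence "i = 0 \<or> i = 1 \<or> i = 2" using assms by auto
    with eq show "v $ i = w $ i" by auto
  qed (use assms in auto)
qed simp

lemma leapfrog_matrix_mult_vec:
  assumes "v \<in> carrier_vec 3"
  shows "(leapfrog_matrix p q *\<^sub>v v) $ 0 = v $ 0 + q * v $ 1 - p * v $ 2"
    and "(leapfrog_matrix p q *\<^sub>v v) $ 1 = v $ 1 - cnj q * (v $ 0 + q * v $ 1 - p * v $ 2)"
    and "(leapfrog_matrix p q *\<^sub>v v) $ 2 = v $ 2 + cnj p * (v $ 0 + q * v $ 1 - p * v $ 2)"
  using assms
  by (simp_all add: leapfrog_matrix_def mat_of_rows_list_def scalar_prod_def sum_upto_3
      algebra_simps numeral_2_eq_2)

lemma leapfrog_step_iff: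
  assumes "v \<in> carrier_vec 3" "w \<in> carrier_vec 3"
  shows "w = leapfrog_matrix p q *\<^sub>v v \<longleftrightarrow>
    w $ 0 = v $ 0 + q * v $ 1 - p * v $ 2 \<and>
    w $ 1 = v $ 1 - cnj q * w $ 0 \<and>
    w $ 2 = v $ 2 + cnj p * w $ 0"
proof -
  have "leapfrog_matrix p q *\<^sub>v v \<in> carrier_vec 3"
    using leapfrog_matrix_carrier assms(1) by (rule mult_mat_vec_carrier)
  from eq_vec_3[OF assms(2) this] show ?thesis
    using leapfrog_matrix_mult_vec[OF assms(1)] by auto
qed

text \<open>The bound is the stability limit of leap-frog for the oscillator whose squared frequency
  times the squared time step is \<open>\<bar>p\<bar>\<^sup>2 + \<bar>q\<bar>\<^sup>2\<close>.\<close>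

lemma leapfrog_eigenvalue_on_unit_circle:
  assumes ev: "eigenvalue (leapfrog_matrix p q) \<mu>"
    and bound: "(cmod p)\<^sup>2 + (cmod q)\<^sup>2 \<le> 4"
  shows "cmod \<mu> = 1"
proof -
  define s where "s = (cmod p)\<^sup>2 + (cmod q)\<^sup>2"
  obtain v where v: "v \<in> carrier_vec 3" "v \<noteq> 0\<^sub>v 3"
    and "leapfrog_matrix p q *\<^sub>v v = \<mu> \<cdot>\<^sub>v v"
    using ev leapfrog_matrix_carrier[of p q] unfolding eigenvalue_def eigenvector_def by auto
  hence "\<mu> \<cdot>\<^sub>v v = leapfrog_matrix p q *\<^sub>v v" by simp
  with v(1) have B: "\<mu> * v $ 0 = v $ 0 + q * v $ 1 - p * v $ 2"
    and Ex: "\<mu> * v $ 1 = v $ 1 - cnj q * (\<mu> * v $ 0)"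
    and Ey: "\<mu> * v $ 2 = v $ 2 + cnj p * (\<mu> * v $ 0)"
    by (simp_all add: leapfrog_step_iff)
  show ?thesis
  proof (cases "v $ 0 = 0")
    case True
    have "v $ 1 \<noteq> 0 \<or> v $ 2 \<noteq> 0"
      using v True eq_vec_3[OF v(1), of "0\<^sub>v 3"] by auto
    with True Ex Ey have "\<mu> = 1" by auto
    thus ?thesis by simp
  next
    case False
    have s: "of_real s = cnj p * p + cnj q * q"
      by (simp only: s_def of_real_add complex_norm_square mult.commute)
    have "(\<mu> - 1)\<^sup>2 * v $ 0 = (\<mu> - 1) * (\<mu> * v $ 0 - v $ 0)"
      by (simp add: power2_eq_square algebra_simps)
    also have "\<mu> * v $ 0 - v $ 0 = q * v $ 1 - p * v $ 2"
      unfolding B by simp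
    also have "(\<mu> - 1) * (q * v $ 1 - p * v $ 2)
        = q * (\<mu> * v $ 1 - v $ 1) - p * (\<mu> * v $ 2 - v $ 2)"
      by (simp add: algebra_simps)
    also have "\<dots> = - of_real s * \<mu> * v $ 0"
      unfolding Ex Ey s by (simp add: algebra_simps)
    finally have "((\<mu> - 1)\<^sup>2 + of_real s * \<mu>) * v $ 0 = 0"
      by (simp add: algebra_simps)
    with False have "(\<mu> - 1)\<^sup>2 + of_real s * \<mu> = 0" by simp
    hence "\<mu>\<^sup>2 - of_real (2 - s) * \<mu> + 1 = 0"
      by (simp add: power2_eq_square algebra_simps)
    moreover have "0 \<le> s" by (simp add: s_def)
    hence "\<bar>2 - s\<bar> \<le> 2" using bound unfolding s_def by linarith
    ultimately show ?thesis by (rule reciprocal_quadratic_root_on_unit_circle)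
  qed
qed

section \<open>The schemes on Fourier modes\<close>

lemma staggered_on_modes_eq_collocated_on_modes:
  "staggered_on_modes = collocated_on_modes"
proof (intro ext)
  fix \<Delta>t \<Delta>x \<Delta>y \<beta>x \<beta>y q
  show "staggered_on_modes \<Delta>t \<Delta>x \<Delta>y \<beta>x \<beta>y q = collocated_on_modes \<Delta>t \<Delta>x \<Delta>y \<beta>x \<beta>y q"
    by (simp add: staggered_on_modes_def collocated_on_modes_def
        staggered_scheme_def collocated_scheme_def)
qed

lemma fourier_mode_shift:
  "fourier_mode \<beta>x \<beta>y a (of_int (i + k)) (of_int (j + l)) =
     a * cis (\<beta>x * of_int k) * cis (\<beta>y * of_int l) * fourier_mode \<beta>x \<beta>y 1 (of_int i) (of_int j)"
  by (simp add: fourier_mode_def cis_conv_exp exp_add [symmetric] algebra_simps)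

text \<open>The Fourier symbol of the difference in the direction of \<open>\<alpha>\<close>, summed over two
  neighbours in the direction of \<open>\<beta>\<close>.\<close>

definition symbol :: "real \<Rightarrow> real \<Rightarrow> complex" where
  "symbol \<alpha> \<beta> = (cis \<alpha> - 1) * (cis \<beta> + 1)"

lemma norm_symbol_squared: "(cmod (symbol \<alpha> \<beta>))\<^sup>2 = 4 * (1 - cos \<alpha>) * (1 + cos \<beta>)"
proof -
  have "(cmod (cis \<alpha> - 1))\<^sup>2 = 2 * (1 - cos \<alpha>)"
    using sin_cos_squared_add[of \<alpha>] by (simp add: cmod_power2 power2_diff)
  moreover have "(cmod (cis \<beta> + 1))\<^sup>2 = 2 * (1 + cos \<beta>)"
    using sin_cos_squared_add[of \<beta>] by (simp add: cmod_power2 power2_sum)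
  ultimately show ?thesis
    by (simp only: symbol_def norm_mult power_mult_distrib)
qed

text \<open>The stencils of \<open>B\<close> are the reflected stencils of the electric field, whose symbols are
  negated conjugates.\<close>

lemma collocated_on_modes_iff:
  fixes \<Delta>t \<Delta>x \<Delta>y \<beta>x \<beta>y :: real
  assumes "\<Delta>t > 0"
  defines "p \<equiv> of_real (\<Delta>t / (2 * \<Delta>x)) * symbol \<beta>x \<beta>y"
    and "r \<equiv> of_real (\<Delta>t / (2 * \<Delta>y)) * symbol \<beta>y \<beta>x"
  shows "collocated_on_modes \<Delta>t \<Delta>x \<Delta>y \<beta>x \<beta>y q \<longleftrightarrow> (\<forall>n.
     q (n+1) $ 0 = q n $ 0 + r * q n $ 1 - p * q n $ 2 \<and>
     q (n+1) $ 1 = q n $ 1 - cnj r * q (n+1) $ 0 \<and>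
     q (n+1) $ 2 = q n $ 2 + cnj p * q (n+1) $ 0)"
proof -
  define w where "w = (\<lambda>i j. fourier_mode \<beta>x \<beta>y 1 (of_int i) (of_int j))"
  have w: "w i j \<noteq> 0" for i j by (simp add: w_def fourier_mode_def)
  have shift: "fourier_mode \<beta>x \<beta>y a (of_int i) (of_int j) = a * w i j"
    "fourier_mode \<beta>x \<beta>y a (of_int (i+1)) (of_int j) = a * cis \<beta>x * w i j"
    "fourier_mode \<beta>x \<beta>y a (of_int i) (of_int (j+1)) = a * cis \<beta>y * w i j"
    "fourier_mode \<beta>x \<beta>y a (of_int (i+1)) (of_int (j+1)) = a * cis \<beta>x * cis \<beta>y * w i j"
    "fourier_mode \<beta>x \<beta>y a (of_int (i-1)) (of_int j) = a * cnj (cis \<beta>x) * w i j"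
    "fourier_mode \<beta>x \<beta>y a (of_int i) (of_int (j-1)) = a * cnj (cis \<beta>y) * w i j"
    "fourier_mode \<beta>x \<beta>y a (of_int (i-1)) (of_int (j-1)) = a * cnj (cis \<beta>x) * cnj (cis \<beta>y) * w i j"
    for a i j
    using fourier_mode_shift[of \<beta>x \<beta>y a i 0 j 0] fourier_mode_shift[of \<beta>x \<beta>y a i 1 j 0]
      fourier_mode_shift[of \<beta>x \<beta>y a i 0 j 1] fourier_mode_shift[of \<beta>x \<beta>y a i 1 j 1]
      fourier_mode_shift[of \<beta>x \<beta>y a i "-1" j 0] fourier_mode_shift[of \<beta>x \<beta>y a i 0 j "-1"]
      fourier_mode_shift[of \<beta>x \<beta>y a i "-1" j "-1"]
    by (simp_all add: w_def cis_cnj)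
  \<comment> \<open>The mode itself never vanishes, so an update holds at one grid point if and only if it holds
     at all of them: each equation becomes one for the amplitudes.\<close>
  have cancel: "(x * w i j - y * w i j) / of_real \<Delta>t = z * w i j / of_real d \<longleftrightarrow>
      x = y + of_real (\<Delta>t / d) * z" for x y z d i j
  proof -
    have "(x * w i j - y * w i j) / of_real \<Delta>t = z * w i j / of_real d \<longleftrightarrow>
        ((x - y) / of_real \<Delta>t) * w i j = (z / of_real d) * w i j"
      by (simp only: left_diff_distrib times_divide_eq_left)
    also have "\<dots> \<longleftrightarrow> (x - y) / of_real \<Delta>t = z / of_real d"
      by (simp only: mult_cancel_right w simp_thms)
    also have "\<dots> \<longleftrightarrow> x - y = of_real (\<Delta>t / d) * z"
      using assms(1) by (simp add: divide_eq_eq mult.commute)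
    finally show ?thesis by (auto simp: algebra_simps)
  qed
  have B_step: "(x * w i j - y * w i j) / of_real \<Delta>t =
      - ((g * cis \<beta>x * cis \<beta>y * w i j - g * cis \<beta>y * w i j + g * cis \<beta>x * w i j - g * w i j)
           / of_real (2 * \<Delta>x)
       - (f * cis \<beta>x * cis \<beta>y * w i j - f * cis \<beta>x * w i j + f * cis \<beta>y * w i j - f * w i j)
           / of_real (2 * \<Delta>y)) \<longleftrightarrow> x = y + r * f - p * g" for x y f g i j
  proof -
    have "- ((g * cis \<beta>x * cis \<beta>y * w i j - g * cis \<beta>y * w i j + g * cis \<beta>x * w i j - g * w i j)
           / of_real (2 * \<Delta>x)
       - (f * cis \<beta>x * cis \<beta>y * w i j - f * cis \<beta>x * w i j + f * cis \<beta>y * w i j - f * w i j)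
           / of_real (2 * \<Delta>y)) =
       (symbol \<beta>y \<beta>x * f / of_real (2 * \<Delta>y) - symbol \<beta>x \<beta>y * g / of_real (2 * \<Delta>x)) * w i j
         / of_real 1"
      by (simp add: symbol_def algebra_simps diff_divide_distrib add_divide_distrib)
    thus ?thesis
      by (simp only: cancel) (simp add: p_def r_def algebra_simps)
  qed
  have Ex_step: "(x * w i j - y * w i j) / of_real \<Delta>t =
      (b * w i j - b * cnj (cis \<beta>y) * w i j + b * cnj (cis \<beta>x) * w i j
        - b * cnj (cis \<beta>x) * cnj (cis \<beta>y) * w i j) / of_real (2 * \<Delta>y) \<longleftrightarrow>
      x = y - cnj r * b" for x y b i j
  proof -
    have "b * w i j - b * cnj (cis \<beta>y) * w i j + b * cnj (cis \<beta>x) * w i j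
        - b * cnj (cis \<beta>x) * cnj (cis \<beta>y) * w i j = (- cnj (symbol \<beta>y \<beta>x) * b) * w i j"
      by (simp add: symbol_def algebra_simps)
    thus ?thesis
      by (simp only: cancel) (simp add: r_def mult.assoc)
  qed
  have Ey_step: "(x * w i j - y * w i j) / of_real \<Delta>t =
      - ((b * w i j - b * cnj (cis \<beta>x) * w i j + b * cnj (cis \<beta>y) * w i j
        - b * cnj (cis \<beta>x) * cnj (cis \<beta>y) * w i j) / of_real (2 * \<Delta>x)) \<longleftrightarrow>
      x = y + cnj p * b" for x y b i j
  proof -
    have "- ((b * w i j - b * cnj (cis \<beta>x) * w i j + b * cnj (cis \<beta>y) * w i j
        - b * cnj (cis \<beta>x) * cnj (cis \<beta>y) * w i j) / of_real (2 * \<Delta>x)) =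
        (cnj (symbol \<beta>x \<beta>y) * b) * w i j / of_real (2 * \<Delta>x)"
      unfolding minus_divide_left by (simp add: symbol_def algebra_simps)
    thus ?thesis
      by (simp only: cancel) (simp add: p_def mult.assoc)
  qed
  show ?thesis
    \<comment> \<open>Doubly shifted modes go first, since a rule for an unshifted index also matches a shifted one.\<close>
    unfolding collocated_on_modes_def collocated_scheme_def shift(4,7)
    unfolding shift(2,3,5,6)
    unfolding shift(1) B_step Ex_step Ey_step by simp
qed

lemma collocated_amplification_matrix:
  assumes "\<Delta>t > 0"
  shows "amplification_matrix (collocated_on_modes \<Delta>t \<Delta>x \<Delta>y \<beta>x \<beta>y)
     (leapfrog_matrix (of_real (\<Delta>t / (2 * \<Delta>x)) * symbol \<beta>x \<beta>y)
        (of_real (\<Delta>t / (2 * \<Delta>y)) * symbol \<beta>y \<beta>x))"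
  unfolding amplification_matrix_def
  using leapfrog_matrix_carrier
  by (simp add: collocated_on_modes_iff[OF assms] leapfrog_step_iff)

text \<open>Each term of \<open>(1 - cos \<beta>x) (1 + cos \<beta>y) + (1 - cos \<beta>y) (1 + cos \<beta>x)\<close> can reach \<open>4\<close>, but
  their sum equals \<open>2 (1 - cos \<beta>x cos \<beta>y)\<close> and never exceeds \<open>4\<close> either.\<close>

lemma norm_symbols_squared_le:
  "(cmod (symbol \<beta>x \<beta>y))\<^sup>2 + (cmod (symbol \<beta>y \<beta>x))\<^sup>2 \<le> 16"
proof -
  have "\<bar>cos \<beta>x * cos \<beta>y\<bar> \<le> 1 * 1"
    unfolding abs_mult by (intro mult_mono) auto
  hence "- (cos \<beta>x * cos \<beta>y) \<le> 1" by linarith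
  thus ?thesis unfolding norm_symbol_squared by (simp add: algebra_simps)
qed

theorem corollaryB1:
  fixes \<Delta>t \<Delta>x \<Delta>y :: real
  assumes "\<Delta>t > 0" and "\<Delta>x > 0" and "\<Delta>y = \<Delta>x" and "\<Delta>t / \<Delta>x < 1"
  shows "von_neumann_stable (collocated_on_modes \<Delta>t \<Delta>x \<Delta>y) \<and>
         von_neumann_stable (staggered_on_modes \<Delta>t \<Delta>x \<Delta>y)"
proof -
  have "von_neumann_stable (collocated_on_modes \<Delta>t \<Delta>x \<Delta>y)"
    unfolding von_neumann_stable_def
  proof (intro allI exI conjI impI)
    fix \<beta>x \<beta>y \<mu>
    let ?c = "\<Delta>t / (2 * \<Delta>x)"
    let ?p = "of_real ?c * symbol \<beta>x \<beta>y" and ?q = "of_real (\<Delta>t / (2 * \<Delta>y)) * symbol \<beta>y \<beta>x"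
    show "amplification_matrix (collocated_on_modes \<Delta>t \<Delta>x \<Delta>y \<beta>x \<beta>y) (leapfrog_matrix ?p ?q)"
      by (rule collocated_amplification_matrix) fact
    assume ev: "eigenvalue (leapfrog_matrix ?p ?q) \<mu>"
    have "(cmod ?p)\<^sup>2 + (cmod ?q)\<^sup>2 = ?c\<^sup>2 * ((cmod (symbol \<beta>x \<beta>y))\<^sup>2 + (cmod (symbol \<beta>y \<beta>x))\<^sup>2)"
      unfolding \<open>\<Delta>y = \<Delta>x\<close> norm_mult norm_of_real power_mult_distrib power2_abs
      by (simp only: distrib_left)
    also have "\<dots> \<le> (1 / 2)\<^sup>2 * 16"
    proof (intro mult_mono norm_symbols_squared_le power_mono)
      show "?c \<le> 1 / 2" "0 \<le> ?c" using assms by (auto simp: field_simps)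
    qed auto
    finally have "(cmod ?p)\<^sup>2 + (cmod ?q)\<^sup>2 \<le> 4" by (simp add: power2_eq_square)
    with ev have "cmod \<mu> = 1" by (rule leapfrog_eigenvalue_on_unit_circle)
    thus "cmod \<mu> \<le> 1" by simp
  qed
  thus ?thesis by (simp add: staggered_on_modes_eq_collocated_on_modes)
qed

end
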